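(* Let $E$ be a $\sigma$-Dedekind complete Banach lattice. Then $E$ has the disjoint weak$^{\star}$ Dunford-Pettis property if and only if $E$ has the uaw-w$^{\star}$DP property.
   Context: A Banach lattice $E$ has the disjoint weak$^{\star}$ Dunford-Pettis property if $\lim_{n\to\infty} f_n(x_n)=0$ for every norm bounded disjoint sequence $(x_n)$ in $E$ and every weak$^{\star}$ null sequence $(f_n)$ in the dual $E'$. A sequence $(x_n)$ in $E$ is uaw-null if $|x_n|\wedge u\to0$ weakly for every $u\in E^+$. $E$ has the uaw-w$^{\star}$DP property if $\lim_{n\to\infty} f_n(x_n)=0$ for every norm bounded uaw-null sequence $(x_n)$ in $E$ and every weak$^{\star}$ null sequence $(f_n)$ in $E'$. *)

theory Defs
  imports "HOL-Analysis.Analysis" "HOL-Library.Lattice_Algebras" "HOL-Library.Lub_Glb"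
begin

class banach_lattice = banach + ordered_real_vector + lattice_ab_group_add_abs +
  assumes norm_mono_abs: "\<bar>x\<bar> \<le> \<bar>y\<bar> \<Longrightarrow> norm x \<le> norm y"

instance real :: banach_lattice
  by standard simp

definition sigma_Dedekind_complete :: "'a::banach_lattice itself \<Rightarrow> bool"
  where "sigma_Dedekind_complete _ \<longleftrightarrow>
    (\<forall>A :: 'a set. countable A \<and> A \<noteq> {} \<and> bdd_above A \<longrightarrow> (\<exists>s. isLub UNIV A s))"

text \<open>The dual is the type of bounded linear functionals with the operator norm.\<close>

definition weakly_null :: "(nat \<Rightarrow> 'a::real_normed_vector) \<Rightarrow> bool"
  where "weakly_null x \<longleftrightarrow>
    (\<forall>g :: 'a \<Rightarrow>\<^sub>L real. (\<lambda>n. blinfun_apply g (x n)) \<longlonglongrightarrow> 0)"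

definition weak_star_null :: "(nat \<Rightarrow> ('a::real_normed_vector \<Rightarrow>\<^sub>L real)) \<Rightarrow> bool"
  where "weak_star_null f \<longleftrightarrow> (\<forall>x. (\<lambda>n. blinfun_apply (f n) x) \<longlonglongrightarrow> 0)"

definition disjoint_seq :: "(nat \<Rightarrow> 'a::banach_lattice) \<Rightarrow> bool"
  where "disjoint_seq x \<longleftrightarrow> (\<forall>m n. m \<noteq> n \<longrightarrow> inf \<bar>x m\<bar> \<bar>x n\<bar> = 0)"

definition uaw_null :: "(nat \<Rightarrow> 'a::banach_lattice) \<Rightarrow> bool"
  where "uaw_null x \<longleftrightarrow> (\<forall>u\<ge>0. weakly_null (\<lambda>n. inf \<bar>x n\<bar> u))"

definition disjoint_weak_star_DP :: "'a::banach_lattice itself \<Rightarrow> bool"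
  where "disjoint_weak_star_DP _ \<longleftrightarrow>
    (\<forall>(x :: nat \<Rightarrow> 'a) (f :: nat \<Rightarrow> ('a \<Rightarrow>\<^sub>L real)).
      bounded (range x) \<and> disjoint_seq x \<and> weak_star_null f \<longrightarrow>
      (\<lambda>n. blinfun_apply (f n) (x n)) \<longlonglongrightarrow> 0)"

definition uaw_weak_star_DP :: "'a::banach_lattice itself \<Rightarrow> bool"
  where "uaw_weak_star_DP _ \<longleftrightarrow>
    (\<forall>(x :: nat \<Rightarrow> 'a) (f :: nat \<Rightarrow> ('a \<Rightarrow>\<^sub>L real)).
      bounded (range x) \<and> uaw_null x \<and> weak_star_null f \<longrightarrow>
      (\<lambda>n. blinfun_apply (f n) (x n)) \<longlonglongrightarrow> 0)"

end

theory Submission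
  imports Defs
begin

text \<open>Disjoint sequences are uaw-null because \<open>(\<Sum>k<N. \<bar>x k\<bar> \<sqinter> u) \<le> u\<close>, which gives one implication.

  For the other, let \<open>f\<close> be weak-star null and first suppose that \<open>z\<close> is positive, weakly null and
  order bounded. If \<open>e k \<ge> 0\<close> has order bounded partial sums, then \<open>\<sigma>\<close>-Dedekind completeness turns
  \<open>S \<mapsto> f n (\<Sum>k\<in>S. e k)\<close> into finitely additive measures on all sets of naturals which tend to zero
  setwise, and Rosenthal's lemma (as in Phillips' lemma) gives \<open>f n (e n) \<longlonglongrightarrow> 0\<close>. Hence the positive parts
  of the \<open>f n\<close> are uniformly Cauchy along monotone order bounded sequences, and the classical passage
  from uniform exhaustivity to uniform absolute continuity gives \<open>f n (z n) \<longlonglongrightarrow> 0\<close>.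

  For a positive bounded uaw-null sequence \<open>x\<close> this applies to all truncations \<open>x n \<sqinter> u\<close>. If \<open>f n (x n)\<close>
  stayed large, one could therefore cut off small pieces and obtain a bounded disjoint sequence,
  subordinate to a subsequence of \<open>x\<close>, contradicting the disjoint weak-star Dunford-Pettis property.\<close>


subsection \<open>Positive parts in a Banach lattice\<close>

lemma norm_pos_mono:
  fixes x :: "'a::banach_lattice"
  assumes "0 \<le> x" "x \<le> y"
  shows "norm x \<le> norm y"
proof -
  have "0 \<le> y"
    using assms by (rule order_trans)
  then show ?thesis
    using assms by (intro norm_mono_abs) simp
qed

lemma norm_abs_lattice: "norm \<bar>x\<bar> = norm (x :: 'a::banach_lattice)"
  by (intro antisym norm_mono_abs) simp_all

text \<open>Vectors are cut at a level \<open>a\<close> throughout; this separates the truncation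
  from the excess \<open>pprt (x - a)\<close>.\<close>

lemma diff_pprt_diff: "x - pprt (x - a) = inf x (a :: 'a::lattice_ab_group_add)"
proof -
  have "x - sup (x - a) 0 = x + inf (- (x - a)) (- 0)"
    by (rule diff_sup_eq_inf)
  also have "\<dots> = inf x a"
    by (simp add: add_inf_distrib_left inf_commute)
  finally show ?thesis
    by (simp add: pprt_def)
qed

lemma pprt_diff_pprt_minus: "pprt x - pprt (- x) = (x :: 'a::lattice_ab_group_add)"
  using prts[of x] by (simp add: pprt_neg)

lemma inf_pprt_pprt_minus: "inf (pprt x) (pprt (- x)) = (0 :: 'a::lattice_ab_group_add)"
proof -
  have "inf (pprt x) (pprt (- x)) = pprt x - pprt (pprt x - pprt (- x))"
    by (rule diff_pprt_diff [symmetric])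
  then show ?thesis
    by (simp only: pprt_diff_pprt_minus) simp
qed

lemma pprt_le_abs: "pprt x \<le> \<bar>x :: 'a::lattice_ab_group_add_abs\<bar>"
  by (simp add: pprt_def abs_ge_self)

lemma pprt_diff_nonneg_le: "0 \<le> a \<Longrightarrow> 0 \<le> x \<Longrightarrow> pprt (x - a) \<le> (x :: 'a::lattice_ab_group_add)"
  by (simp add: pprt_def)

lemma inf_add_le:
  fixes x :: "'a::lattice_ab_group_add"
  assumes "0 \<le> b"
  shows "inf x (a + b) \<le> inf x a + b"
  using assms by (simp add: add_inf_distrib_right le_infI1 add_increasing2)

lemma pprt_scaleR_ge:
  fixes x :: "'a::banach_lattice"
  assumes "0 < c"
  shows "c *\<^sub>R pprt x \<le> pprt (c *\<^sub>R x)"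
proof -
  have "pprt x \<le> inverse c *\<^sub>R pprt (c *\<^sub>R x)"
  proof -
    have "inverse c *\<^sub>R (c *\<^sub>R x) \<le> inverse c *\<^sub>R pprt (c *\<^sub>R x)"
      using assms by (intro scaleR_left_mono) (simp_all add: pprt_def)
    moreover have "0 \<le> inverse c *\<^sub>R pprt (c *\<^sub>R x)"
      using assms by (intro scaleR_nonneg_nonneg) simp_all
    ultimately show ?thesis
      using assms by (simp add: pprt_def[of x])
  qed
  then have "c *\<^sub>R pprt x \<le> c *\<^sub>R (inverse c *\<^sub>R pprt (c *\<^sub>R x))"
    using assms by (intro scaleR_left_mono) simp_all
  then show ?thesis
    using assms by simp
qed

text \<open>Multiplied by \<open>c\<close>, the bound on \<open>z\<close> lies below the negative
  part of \<open>a - c *\<^sub>R b\<close>, whose positive part bounds \<open>y\<close>;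
  \<open>1 \<le> c\<close> makes this multiplication an enlargement.\<close>

lemma disjoint_pprt_diff_scaleR:
  fixes a b :: "'a::banach_lattice"
  assumes c: "1 \<le> c" and y: "0 \<le> y" "y \<le> pprt (a - c *\<^sub>R b)"
    and z: "0 \<le> z" "z \<le> pprt (b - inverse c *\<^sub>R a)"
  shows "inf y z = 0"
proof (rule antisym)
  have "pprt (b - inverse c *\<^sub>R a) \<le> c *\<^sub>R pprt (b - inverse c *\<^sub>R a)"
    using scaleR_right_mono[OF c zero_le_pprt] by simp
  also have "\<dots> \<le> pprt (c *\<^sub>R (b - inverse c *\<^sub>R a))"
    using c by (intro pprt_scaleR_ge) simp
  also have "c *\<^sub>R (b - inverse c *\<^sub>R a) = - (a - c *\<^sub>R b)"
    using c by (simp add: scaleR_diff_right)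
  finally have "z \<le> pprt (- (a - c *\<^sub>R b))"
    using z by (meson order_trans)
  then have "inf y z \<le> inf (pprt (a - c *\<^sub>R b)) (pprt (- (a - c *\<^sub>R b)))"
    using y by (intro inf_mono)
  also have "\<dots> = 0"
    by (rule inf_pprt_pprt_minus)
  finally show "inf y z \<le> 0" .
  show "0 \<le> inf y z"
    using y z by simp
qed

text \<open>The negative part of a limit \<open>l\<close> is dominated by
  \<open>\<bar>x n - l\<bar>\<close>, so its norm vanishes.\<close>

lemma closed_nonneg: "closed {x :: 'a::banach_lattice. 0 \<le> x}"
  unfolding closed_sequential_limits
proof (intro allI impI)
  fix x :: "nat \<Rightarrow> 'a" and l
  assume "(\<forall>n. x n \<in> {x. 0 \<le> x}) \<and> x \<longlonglongrightarrow> l"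
  then have pos: "0 \<le> x n" and lim: "x \<longlonglongrightarrow> l" for n
    by auto
  have "norm (pprt (- l)) \<le> norm (x n - l)" for n
  proof -
    have "pprt (- l) \<le> \<bar>x n - l\<bar>"
      unfolding pprt_def
    proof (rule le_supI)
      have "- l \<le> x n - l"
        using pos[of n] by simp
      then show "- l \<le> \<bar>x n - l\<bar>"
        using abs_ge_self order_trans by blast
    qed simp
    then show ?thesis
      by (intro norm_mono_abs) simp
  qed
  moreover have "(\<lambda>n. norm (x n - l)) \<longlonglongrightarrow> 0"
    using lim by (simp add: LIM_zero_iff tendsto_norm_zero_iff)
  ultimately have "norm (pprt (- l)) \<le> 0"
    by (meson LIMSEQ_le_const)
  then show "l \<in> {x. 0 \<le> x}"
    using le_zero_iff_zero_pprt[of "- l"] by simp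
qed

lemma nonneg_le_suminf:
  fixes x :: "nat \<Rightarrow> 'a::banach_lattice"
  assumes "summable x" "\<And>n. 0 \<le> x n"
  shows "x k \<le> (\<Sum>n. x n)"
proof -
  have "(\<lambda>n. (\<Sum>i<n. x i) - x k) \<longlonglongrightarrow> (\<Sum>n. x n) - x k"
    using assms(1) by (intro tendsto_diff tendsto_const summable_LIMSEQ)
  moreover have "\<forall>\<^sub>F n in sequentially. (\<Sum>i<n. x i) - x k \<in> {x. 0 \<le> x}"
  proof (rule eventually_sequentiallyI)
    fix n assume "Suc k \<le> n"
    then have "x k \<le> (\<Sum>i<n. x i)"
      using assms(2) sum_mono2[of "{..<n}" "{k}" x] by simp
    then show "(\<Sum>i<n. x i) - x k \<in> {x. 0 \<le> x}"
      by simp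
  qed
  ultimately have "(\<Sum>n. x n) - x k \<in> {x. 0 \<le> x}"
    using closed_nonneg by (intro Lim_in_closed_set) auto
  then show ?thesis
    by simp
qed

subsection \<open>The positive part of a functional\<close>

text \<open>The Riesz-Kantorovich formula for the positive part of \<open>f\<close>, meaningful on
  the positive cone only.\<close>

definition pos_cone :: "('a::banach_lattice \<Rightarrow>\<^sub>L real) \<Rightarrow> 'a \<Rightarrow> real"
  where "pos_cone f u = (SUP y\<in>{0..u}. blinfun_apply f y)"

lemma blinfun_le_on_interval:
  fixes f :: "'a::banach_lattice \<Rightarrow>\<^sub>L real"
  assumes "0 \<le> y" "y \<le> u"
  shows "blinfun_apply f y \<le> norm f * norm u"
proof -
  have "blinfun_apply f y \<le> norm f * norm y"
    using norm_blinfun[of f y] by simp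
  also have "\<dots> \<le> norm f * norm u"
    using assms by (intro mult_left_mono norm_pos_mono) simp_all
  finally show ?thesis .
qed

lemma pos_cone_upper:
  assumes "0 \<le> y" "y \<le> u"
  shows "blinfun_apply f y \<le> pos_cone f u"
  unfolding pos_cone_def
  using assms
  by (intro cSUP_upper bdd_aboveI2[where M = "norm f * norm u"] blinfun_le_on_interval) auto

lemma pos_cone_least:
  assumes "0 \<le> u" "\<And>y. 0 \<le> y \<Longrightarrow> y \<le> u \<Longrightarrow> blinfun_apply f y \<le> c"
  shows "pos_cone f u \<le> c"
  unfolding pos_cone_def using assms by (intro cSUP_least) auto

lemma pos_cone_nonneg: "0 \<le> u \<Longrightarrow> 0 \<le> pos_cone f u"
  using pos_cone_upper[of 0 u f] by (simp add: blinfun.zero_right)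

text \<open>Riesz decomposition: any positive \<open>y\<close> below \<open>u + v\<close> is
  \<open>inf y u\<close> plus an excess below \<open>v\<close>. Conversely, sums of elements below
  \<open>u\<close> and below \<open>v\<close> compete in the supremum for
  \<open>u + v\<close>.\<close>

lemma pos_cone_add:
  assumes "0 \<le> u" "0 \<le> v"
  shows "pos_cone f (u + v) = pos_cone f u + pos_cone f v"
proof (rule antisym)
  show "pos_cone f (u + v) \<le> pos_cone f u + pos_cone f v"
  proof (rule pos_cone_least)
    fix y assume y: "0 \<le> y" "y \<le> u + v"
    have "blinfun_apply f y = blinfun_apply f (inf y u) + blinfun_apply f (pprt (y - u))"
      by (simp flip: blinfun.add_right add: diff_pprt_diff [symmetric])
    also have "\<dots> \<le> pos_cone f u + pos_cone f v"
      using assms y by (intro add_mono pos_cone_upper) (auto simp: pprt_def diff_le_eq add.commute)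
    finally show "blinfun_apply f y \<le> pos_cone f u + pos_cone f v" .
  qed (use assms in simp)
  have "pos_cone f u \<le> pos_cone f (u + v) - pos_cone f v"
  proof (rule pos_cone_least)
    fix y assume y: "0 \<le> y" "y \<le> u"
    have "pos_cone f v \<le> pos_cone f (u + v) - blinfun_apply f y"
    proof (rule pos_cone_least)
      fix z assume "0 \<le> z" "z \<le> v"
      then have "blinfun_apply f (y + z) \<le> pos_cone f (u + v)"
        using y by (intro pos_cone_upper add_mono add_nonneg_nonneg)
      then show "blinfun_apply f z \<le> pos_cone f (u + v) - blinfun_apply f y"
        by (simp add: blinfun.add_right)
    qed (use assms in simp)
    then show "blinfun_apply f y \<le> pos_cone f (u + v) - pos_cone f v"
      by simp
  qed (use assms in simp)
  then show "pos_cone f u + pos_cone f v \<le> pos_cone f (u + v)"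
    by simp
qed

lemma pos_cone_scaleR_le:
  assumes "0 < c" "0 \<le> u"
  shows "pos_cone f (c *\<^sub>R u) \<le> c * pos_cone f u"
proof (rule pos_cone_least)
  fix y assume y: "0 \<le> y" "y \<le> c *\<^sub>R u"
  have "inverse c *\<^sub>R y \<le> inverse c *\<^sub>R (c *\<^sub>R u)"
    using y assms by (intro scaleR_left_mono) simp_all
  then have "blinfun_apply f (inverse c *\<^sub>R y) \<le> pos_cone f u"
    using y assms by (intro pos_cone_upper scaleR_nonneg_nonneg) simp_all
  then show "blinfun_apply f y \<le> c * pos_cone f u"
    using assms by (simp add: blinfun.scaleR_right field_simps)
qed (use assms in \<open>simp add: scaleR_nonneg_nonneg\<close>)

lemma pos_cone_scaleR:
  assumes "0 < c" "0 \<le> u"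
  shows "pos_cone f (c *\<^sub>R u) = c * pos_cone f u"
proof (rule antisym)
  have "pos_cone f (inverse c *\<^sub>R (c *\<^sub>R u)) \<le> inverse c * pos_cone f (c *\<^sub>R u)"
    using assms by (intro pos_cone_scaleR_le scaleR_nonneg_nonneg) simp_all
  then show "c * pos_cone f u \<le> pos_cone f (c *\<^sub>R u)"
    using assms by (simp add: field_simps)
qed (use assms in \<open>rule pos_cone_scaleR_le\<close>)

text \<open>Kantorovich's extension from the cone to a linear functional on the whole space.\<close>

definition pos_fun :: "('a::banach_lattice \<Rightarrow>\<^sub>L real) \<Rightarrow> 'a \<Rightarrow> real"
  where "pos_fun f x = pos_cone f (pprt x) - pos_cone f (pprt (- x))"

text \<open>Additivity on the cone makes the value independent of the decomposition, so linearity
  can be checked with whichever decomposition is convenient.\<close>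

lemma pos_fun_eq_diff:
  assumes "0 \<le> a" "0 \<le> b" "x = a - b"
  shows "pos_fun f x = pos_cone f a - pos_cone f b"
proof -
  have "pprt x + b = a + pprt (- x)"
    using trans[OF pprt_diff_pprt_minus assms(3)] by (simp add: diff_eq_eq diff_add_eq)
  then have "pos_cone f (pprt x + b) = pos_cone f (a + pprt (- x))"
    by simp
  then show ?thesis
    using assms by (simp add: pos_cone_add pos_fun_def)
qed

lemma pos_fun_nonneg_eq: "0 \<le> u \<Longrightarrow> pos_fun f u = pos_cone f u"
  using pos_cone_add[of 0 0 f] by (simp add: pos_fun_eq_diff[of u 0])

lemma pos_fun_add: "pos_fun f (x + y) = pos_fun f x + pos_fun f y"
proof -
  have "x + y = (pprt x + pprt y) - (pprt (- x) + pprt (- y))"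
    using pprt_diff_pprt_minus[of x] pprt_diff_pprt_minus[of y] by (simp add: algebra_simps)
  then have "pos_fun f (x + y) = pos_cone f (pprt x + pprt y) - pos_cone f (pprt (- x) + pprt (- y))"
    by (intro pos_fun_eq_diff) simp_all
  then show ?thesis
    by (simp add: pos_cone_add pos_fun_def)
qed

lemma pos_fun_scaleR: "pos_fun f (c *\<^sub>R x) = c * pos_fun f x"
proof -
  have pos: "pos_fun f (c *\<^sub>R x) = c * pos_fun f x" if "0 < c" for c x
  proof -
    have "c *\<^sub>R x = c *\<^sub>R pprt x - c *\<^sub>R pprt (- x)"
      by (simp flip: scaleR_diff_right add: pprt_diff_pprt_minus)
    then have "pos_fun f (c *\<^sub>R x) = pos_cone f (c *\<^sub>R pprt x) - pos_cone f (c *\<^sub>R pprt (- x))"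
      using that by (intro pos_fun_eq_diff scaleR_nonneg_nonneg) simp_all
    then show ?thesis
      using that by (simp add: pos_cone_scaleR pos_fun_def right_diff_distrib)
  qed
  have neg: "pos_fun f (- x) = - pos_fun f x" for x
    by (simp add: pos_fun_def)
  show ?thesis
  proof (cases c "0 :: real" rule: linorder_cases)
    case less
    then show ?thesis
      using pos[of "- c" x] neg[of "c *\<^sub>R x"] by simp
  qed (use pos in \<open>simp_all add: pos_fun_def\<close>)
qed

lemma abs_pos_fun_le: "\<bar>pos_fun f x\<bar> \<le> norm f * norm x"
proof -
  have "pos_cone f (pprt x) \<le> norm f * norm x" for x
  proof -
    have "pos_cone f (pprt x) \<le> norm f * norm (pprt x)"
      by (intro pos_cone_least blinfun_le_on_interval) simp_all
    also have "\<dots> \<le> norm f * norm x"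
      using pprt_le_abs[of x] by (intro mult_left_mono norm_mono_abs) simp_all
    finally show ?thesis .
  qed
  from this[of x] this[of "- x"] show ?thesis
    using pos_cone_nonneg[of "pprt x" f] pos_cone_nonneg[of "pprt (- x)" f]
    by (simp add: pos_fun_def)
qed

text \<open>The positive part of \<open>f\<close> in the dual; \<open>pos_blinfun (- f)\<close> is
  the negative part.\<close>

definition pos_blinfun :: "('a::banach_lattice \<Rightarrow>\<^sub>L real) \<Rightarrow> ('a \<Rightarrow>\<^sub>L real)"
  where "pos_blinfun f = Blinfun (pos_fun f)"

lemma pos_blinfun_apply: "blinfun_apply (pos_blinfun f) = pos_fun f"
  unfolding pos_blinfun_def
proof (rule bounded_linear_Blinfun_apply)
  show "bounded_linear (pos_fun f)"
    using abs_pos_fun_le[of f]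
    by (intro bounded_linear_intro[where K = "norm f"])
      (simp_all add: pos_fun_add pos_fun_scaleR mult.commute)
qed

lemma le_pos_blinfun:
  assumes "0 \<le> y" "y \<le> u"
  shows "blinfun_apply f y \<le> blinfun_apply (pos_blinfun f) u"
proof -
  have "0 \<le> u"
    using assms by (rule order_trans)
  then show ?thesis
    using pos_cone_upper[OF assms] by (simp add: pos_blinfun_apply pos_fun_nonneg_eq)
qed

lemma less_pos_blinfunD:
  assumes "0 \<le> u" "c < blinfun_apply (pos_blinfun f) u"
  obtains y where "0 \<le> y" "y \<le> u" "c < blinfun_apply f y"
  using pos_cone_least[of u f c] assms
  by (metis not_le pos_blinfun_apply pos_fun_nonneg_eq)

lemma pos_blinfun_nonneg: "0 \<le> u \<Longrightarrow> 0 \<le> blinfun_apply (pos_blinfun f) u"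
  by (simp add: pos_blinfun_apply pos_fun_nonneg_eq pos_cone_nonneg)

lemma pos_blinfun_mono: "u \<le> v \<Longrightarrow> blinfun_apply (pos_blinfun f) u \<le> blinfun_apply (pos_blinfun f) v"
  using pos_blinfun_nonneg[of "v - u" f] by (simp add: blinfun.diff_right)

lemma pos_blinfun_le_norm: "blinfun_apply (pos_blinfun f) u \<le> norm f * norm u"
  using abs_pos_fun_le[of f u] by (simp add: pos_blinfun_apply)

lemma ge_neg_pos_blinfun:
  "0 \<le> y \<Longrightarrow> y \<le> u \<Longrightarrow> - blinfun_apply (pos_blinfun (- f)) u \<le> blinfun_apply f y"
  using le_pos_blinfun[of y u "- f"] by (simp add: blinfun.minus_left)

text \<open>Each \<open>g\<close> is squeezed on \<open>z\<close> between minus its negative part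
  and its positive part, both evaluated at \<open>w\<close>.\<close>

lemma weakly_null_if_dominated:
  fixes z w :: "nat \<Rightarrow> 'a::banach_lattice"
  assumes z: "\<And>n. 0 \<le> z n" "\<And>n. z n \<le> w n"
    and w: "\<And>g. (\<lambda>n. blinfun_apply (pos_blinfun g) (w n)) \<longlonglongrightarrow> 0"
  shows "weakly_null z"
  unfolding weakly_null_def
proof
  fix g :: "'a \<Rightarrow>\<^sub>L real"
  show "(\<lambda>n. blinfun_apply g (z n)) \<longlonglongrightarrow> 0"
  proof (rule tendsto_sandwich)
    show "\<forall>\<^sub>F n in sequentially. - blinfun_apply (pos_blinfun (- g)) (w n) \<le> blinfun_apply g (z n)"
      using z by (intro always_eventually allI ge_neg_pos_blinfun)
    show "\<forall>\<^sub>F n in sequentially. blinfun_apply g (z n) \<le> blinfun_apply (pos_blinfun g) (w n)"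
      using z by (intro always_eventually allI le_pos_blinfun)
    show "(\<lambda>n. - blinfun_apply (pos_blinfun (- g)) (w n)) \<longlonglongrightarrow> 0"
      using tendsto_minus[OF w] by simp
  qed (rule w)
qed


subsection \<open>Uniform boundedness\<close>

text \<open>If \<open>y\<close> has norm \<open>r\<close> and nearly norms \<open>T\<close>, then
  \<open>2 T y = T (x + y) - T (x - y)\<close> forces a large value at \<open>x + y\<close> or at
  \<open>x - y\<close>.\<close>

lemma blinfun_large_near:
  fixes T :: "'a::real_normed_vector \<Rightarrow>\<^sub>L 'b::real_normed_vector"
  assumes "0 < r"
  shows "\<exists>x'. norm (x' - x) \<le> r \<and> 2/3 * r * norm T \<le> norm (blinfun_apply T x')"
proof (cases "T = 0")
  case True
  then show ?thesis
    using assms by (intro exI[of _ x]) simp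
next
  case False
  have "\<exists>y0. 2/3 * norm T * norm y0 < norm (blinfun_apply T y0)"
  proof (rule ccontr)
    assume "\<not> ?thesis"
    then have "norm T \<le> 2/3 * norm T"
      by (intro norm_blinfun_bound) (auto simp: not_less)
    with False show False
      by simp
  qed
  then obtain y0 where y0: "2/3 * norm T * norm y0 < norm (blinfun_apply T y0)"
    by blast
  then have nz: "y0 \<noteq> 0"
    by (auto simp: blinfun.zero_right)
  define y where "y = (r / norm y0) *\<^sub>R y0"
  have ny: "norm y = r"
    using nz assms by (simp add: y_def)
  have "norm (blinfun_apply T y) = (r / norm y0) * norm (blinfun_apply T y0)"
    using assms by (simp add: y_def blinfun.scaleR_right)
  moreover have "(r / norm y0) * (2/3 * norm T * norm y0) \<le> (r / norm y0) * norm (blinfun_apply T y0)"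
    using y0 assms by (intro mult_left_mono) simp_all
  ultimately have Ty: "2/3 * r * norm T \<le> norm (blinfun_apply T y)"
    using nz by (simp add: mult_ac)
  have "2 *\<^sub>R blinfun_apply T y = blinfun_apply T (x + y) - blinfun_apply T (x - y)"
    by (simp add: blinfun.add_right blinfun.diff_right scaleR_2)
  then have "2 * norm (blinfun_apply T y) \<le> norm (blinfun_apply T (x + y)) + norm (blinfun_apply T (x - y))"
    by (metis norm_scaleR norm_triangle_ineq4 abs_numeral)
  then have "2/3 * r * norm T \<le> norm (blinfun_apply T (x + y)) \<or>
      2/3 * r * norm T \<le> norm (blinfun_apply T (x - y))"
    using Ty by linarith
  then show ?thesis
    using ny by (metis add_diff_cancel_left' diff_add_cancel minus_diff_eq norm_minus_cancel order_refl)
qed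

text \<open>Sokal's gliding argument: the steps \<^term>\<open>(1/3 :: real) ^ k\<close> are summable, whereas
  the norms \<^term>\<open>(4 :: real) ^ k\<close> outweigh them.\<close>

lemma uniform_boundedness:
  fixes f :: "nat \<Rightarrow> 'a::banach \<Rightarrow>\<^sub>L 'b::real_normed_vector"
  assumes "\<And>x. bounded (range (\<lambda>n. blinfun_apply (f n) x))"
  shows "bounded (range f)"
proof (rule ccontr)
  assume "\<not> bounded (range f)"
  then have "\<exists>n. 4 ^ k < norm (f n)" for k :: nat
    unfolding bounded_iff by (metis rangeE not_le)
  then obtain i where i: "4 ^ k < norm (f (i k))" for k
    by metis
  define T where "T k = f (i k)" for k
  have "\<exists>x. \<forall>k. True \<and> (norm (x (Suc k) - x k) \<le> (1/3) ^ k \<and>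
      2/3 * (1/3) ^ k * norm (T k) \<le> norm (blinfun_apply (T k) (x (Suc k))))"
  proof (rule dependent_nat_choice)
    show "\<exists>x'. True \<and> (norm (x' - x) \<le> (1/3) ^ k \<and>
        2/3 * (1/3) ^ k * norm (T k) \<le> norm (blinfun_apply (T k) x'))" for x k
      using blinfun_large_near[of "(1/3) ^ k" x "T k"] by simp
  qed simp
  then obtain x where x: "norm (x (Suc k) - x k) \<le> (1/3) ^ k"
    "2/3 * (1/3) ^ k * norm (T k) \<le> norm (blinfun_apply (T k) (x (Suc k)))" for k
    by blast
  define d where "d k = x (Suc k) - x k" for k
  have geo: "summable (\<lambda>k. (1/3 :: real) ^ k)"
    by simp
  have sd: "summable (\<lambda>k. norm (d k))"
    using x(1) by (intro summable_comparison_test'[OF geo, of 0]) (simp add: d_def)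
  define y where "y = x 0 + (\<Sum>k. d k)"
  \<comment> \<open>The later steps sum to at most \<open>3/2 * (1/3) ^ Suc k\<close>. In units of
    \<open>(1/3) ^ k * norm (T k)\<close>, passing from \<open>x (Suc k)\<close> to \<open>y\<close>
    thus costs at most \<open>1/2\<close> of the \<open>2/3\<close> gained, leaving
    \<open>1/6\<close>.\<close>
  have dist: "norm (x (Suc k) - y) \<le> 1/2 * (1/3) ^ k" for k
  proof -
    have "y - x (Suc k) = (\<Sum>n. d (n + Suc k))"
      using suminf_split_initial_segment[OF summable_norm_cancel[OF sd], of "Suc k"]
        sum_lessThan_telescope[of x "Suc k"]
      by (simp add: y_def d_def del: sum.lessThan_Suc)
    also have "norm \<dots> \<le> (\<Sum>n. norm (d (n + Suc k)))"
      by (intro summable_norm summable_ignore_initial_segment sd)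
    also have "\<dots> \<le> (\<Sum>n. (1/3) ^ (n + Suc k))"
      unfolding d_def
      by (rule suminf_le[OF x(1) summable_ignore_initial_segment[OF sd, unfolded d_def]
          summable_ignore_initial_segment[OF geo]])
    also have "\<dots> = (\<Sum>n. (1/3) ^ n) * (1/3) ^ Suc k"
      unfolding power_add by (intro suminf_mult2 [symmetric] geo)
    also have "\<dots> = 1/2 * (1/3) ^ k"
      by (simp add: suminf_geometric)
    finally show ?thesis
      by (simp add: norm_minus_commute)
  qed
  have low: "1/6 * (4/3) ^ k \<le> norm (blinfun_apply (T k) y)" for k
  proof -
    have "norm (blinfun_apply (T k) (x (Suc k)) - blinfun_apply (T k) y) \<le> norm (T k) * (1/2 * (1/3) ^ k)"
      using mult_left_mono[OF dist[of k], of "norm (T k)"] norm_blinfun[of "T k" "x (Suc k) - y"]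
      by (simp add: blinfun.diff_right)
    then have "1/6 * (1/3) ^ k * norm (T k) \<le> norm (blinfun_apply (T k) y)"
      using x(2)[of k] norm_triangle_ineq2[of "blinfun_apply (T k) (x (Suc k))" "blinfun_apply (T k) y"]
      by (simp add: algebra_simps)
    moreover have "1/6 * (1/3) ^ k * 4 ^ k \<le> 1/6 * (1/3) ^ k * norm (T k)"
      using i[of k] by (intro mult_left_mono) (simp_all add: T_def)
    ultimately show ?thesis
      by (simp add: power_divide)
  qed
  obtain M where M: "norm (blinfun_apply (f n) y) \<le> M" for n
    using assms[of y] unfolding bounded_iff by auto
  obtain k where "6 * M < (4/3) ^ k"
    using real_arch_pow[of "4/3" "6 * M"] by auto
  then show False
    using low[of k] M[of "i k"] by (simp add: T_def)
qed

text \<open>Pointwise convergence gives pointwise boundedness, to which uniform boundedness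
  applies.\<close>

lemma weak_star_null_bounded:
  fixes f :: "nat \<Rightarrow> 'a::banach \<Rightarrow>\<^sub>L real"
  assumes "weak_star_null f"
  obtains M where "0 \<le> M" "\<And>n. norm (f n) \<le> M"
proof -
  have "bounded (range f)"
    using assms
    by (intro uniform_boundedness convergent_imp_bounded) (auto simp: weak_star_null_def)
  then obtain M where M: "norm (f n) \<le> M" for n
    unfolding bounded_iff by auto
  from M[of 0] have "0 \<le> M"
    by (rule order_trans[OF norm_ge_zero])
  with M show thesis
    using that by blast
qed

lemma weak_star_null_subseq:
  "weak_star_null f \<Longrightarrow> strict_mono r \<Longrightarrow> weak_star_null (\<lambda>k. f (r k))"
  unfolding weak_star_null_def
  using LIMSEQ_subseq_LIMSEQ[of "\<lambda>n. blinfun_apply (f n) x" 0 r for x] by (simp add: comp_def)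

subsection \<open>Rosenthal's disjointification lemma\<close>

lemma infinite_partition_nat:
  assumes "infinite (A :: nat set)"
  shows "\<exists>N :: nat \<Rightarrow> nat set. (\<forall>p. infinite (N p) \<and> N p \<subseteq> A) \<and>
    (\<forall>p q. p \<noteq> q \<longrightarrow> N p \<inter> N q = {})"
proof -
  \<comment> \<open>The pairing function arranges the enumeration of \<open>A\<close> in a double
    array, whose rows are the pieces.\<close>
  define h where "h p q = enumerate A (prod_encode (p, q))" for p q
  have inj: "h p q = h p' q' \<longleftrightarrow> p = p' \<and> q = q'" for p q p' q'
    using strict_mono_enumerate[OF assms] by (simp add: h_def strict_mono_eq)
  show ?thesis
  proof (intro exI[of _ "\<lambda>p. range (h p)"] conjI allI impI)
    show "infinite (range (h p))" for p
      by (intro range_inj_infinite injI) (simp add: inj)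
    show "range (h p) \<subseteq> A" for p
      using assms by (auto simp: h_def enumerate_in_set)
    show "range (h p) \<inter> range (h q) = {}" if "p \<noteq> q" for p q
      using that by (auto simp: inj)
  qed
qed

text \<open>Each failed attempt to find the set among the pieces of an infinite partition lowers the
  total mass by \<open>\<epsilon>\<close>.\<close>

lemma rosenthal_disjointification:
  fixes V :: "nat \<Rightarrow> nat set \<Rightarrow> real"
  assumes nonneg: "\<And>k A. 0 \<le> V k A"
    and superadd: "\<And>k A B. A \<inter> B = {} \<Longrightarrow> V k A + V k B \<le> V k (A \<union> B)"
    and "0 < \<epsilon>" "infinite A" "\<And>k. k \<in> A \<Longrightarrow> V k A \<le> real m * \<epsilon>"
  shows "\<exists>B\<subseteq>A. infinite B \<and> (\<forall>k\<in>B. V k (B - {k}) \<le> \<epsilon>)"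
  using assms(4,5)
proof (induction m arbitrary: A)
  case 0
  have mono: "V k A \<le> V k B" if "A \<subseteq> B" for k A B
    using superadd[of A "B - A" k] nonneg[of k "B - A"] that by (simp add: Un_absorb1)
  have "V k (A - {k}) \<le> \<epsilon>" if "k \<in> A" for k
    using mono[of "A - {k}" A k] 0(2)[OF that] \<open>0 < \<epsilon>\<close> by auto
  then show ?case
    using 0(1) by blast
next
  case (Suc m)
  have mono: "V k A \<le> V k B" if "A \<subseteq> B" for k A B
    using superadd[of A "B - A" k] nonneg[of k "B - A"] that by (simp add: Un_absorb1)
  obtain N :: "nat \<Rightarrow> nat set" where "(\<forall>p. infinite (N p) \<and> N p \<subseteq> A) \<and>
    (\<forall>p q. p \<noteq> q \<longrightarrow> N p \<inter> N q = {})"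
    using infinite_partition_nat[OF Suc.prems(1)] ..
  then have N: "infinite (N p)" "N p \<subseteq> A" "p \<noteq> q \<Longrightarrow> N p \<inter> N q = {}" for p q
    by simp_all
  show ?case
  proof (cases "\<exists>p. \<forall>k\<in>N p. V k (N p - {k}) \<le> \<epsilon>")
    case True
    then show ?thesis
      using N by blast
  next
    case False
    \<comment> \<open>One offending index per piece. \<open>range k\<close> meets \<open>N p\<close>
      only in \<open>k p\<close>, so it is disjoint from \<open>N p - {k p}\<close>, whose mass
      exceeds \<open>\<epsilon>\<close>; superadditivity leaves at most
      \<open>real m * \<epsilon>\<close> for \<open>range k\<close>.\<close>
    then obtain k where k: "k p \<in> N p" "\<epsilon> < V (k p) (N p - {k p})" for p
      by (metis not_le)
    have "inj k"
    proof (rule injI, rule ccontr)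
      fix p q assume "k p = k q" "p \<noteq> q"
      then show False
        using k(1)[of p] k(1)[of q] N(3)[of p q] by auto
    qed
    then have inf: "infinite (range k)"
      by (rule range_inj_infinite)
    have sub: "range k \<subseteq> A"
      using k(1) N(2) by (meson image_subsetI subsetD)
    have "V l (range k) \<le> real m * \<epsilon>" if l: "l \<in> range k" for l
    proof -
      obtain p where p: "l = k p"
        using l by blast
      have "k q \<notin> N p - {k p}" for q
        using k(1)[of q] N(3)[of p q] by (cases "p = q") auto
      then have disj: "(N p - {k p}) \<inter> range k = {}"
        by auto
      have "V l (N p - {k p}) + V l (range k) \<le> V l ((N p - {k p}) \<union> range k)"
        by (rule superadd[OF disj])
      also have "\<dots> \<le> V l A"
        using sub N(2)[of p] by (intro mono) auto
      also have "\<dots> \<le> real (Suc m) * \<epsilon>"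
        using l sub by (intro Suc.prems) blast
      finally show ?thesis
        using k(2)[of p] p by (simp add: algebra_simps)
    qed
    from Suc.IH[OF inf this] show ?thesis
      using subset_trans[OF _ sub] by metis
  qed
qed

subsection \<open>Weak-star null sequences on order intervals\<close>

lemma sigma_Dedekind_complete_sup:
  assumes "sigma_Dedekind_complete TYPE('a::banach_lattice)"
    and "\<And>n::nat. x n \<le> (u :: 'a)"
  shows "\<exists>s. (\<forall>n. x n \<le> s) \<and> (\<forall>b. (\<forall>n. x n \<le> b) \<longrightarrow> s \<le> b)"
proof -
  have "\<exists>s. isLub UNIV (range x) s"
    using assms unfolding sigma_Dedekind_complete_def
    by (metis bdd_aboveI2 countableI_type countable_image empty_not_UNIV image_is_empty)
  then show ?thesis
    by (auto simp: isLub_def leastP_def isUb_def setle_def setge_def)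
qed

text \<open>If every diagonal value exceeded \<open>\<epsilon>\<close>, a set \<open>B\<close> with
  off-diagonal negative mass at most \<open>\<epsilon> / 2\<close> would give
  \<open>f k (s B) > \<epsilon> / 2\<close> for infinitely many \<open>k\<close>, against weak-star
  nullness at the single vector \<open>s B\<close>.\<close>

lemma weak_star_null_series:
  fixes e :: "nat \<Rightarrow> 'a::banach_lattice"
  assumes sdc: "sigma_Dedekind_complete TYPE('a)" and f: "weak_star_null f"
    and e: "\<And>k. 0 \<le> e k" and u: "\<And>N. (\<Sum>k<N. e k) \<le> u" and "0 < \<epsilon>"
  shows "\<exists>k. blinfun_apply (f k) (e k) \<le> \<epsilon>"
proof (rule ccontr)
  assume "\<not> ?thesis"
  then have large: "\<epsilon> < blinfun_apply (f k) (e k)" for k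
    by (simp add: not_le)
  define S where "S A N = (\<Sum>k\<in>A \<inter> {..<N}. e k)" for A N
  have S_le: "S A N \<le> u" for A N
  proof -
    have "S A N \<le> (\<Sum>k<N. e k)"
      unfolding S_def using e by (intro sum_mono2) auto
    then show ?thesis
      using u order_trans by blast
  qed
  have S_mono: "S A N \<le> S A N'" if "N \<le> N'" for A N N'
    unfolding S_def using e that by (intro sum_mono2) auto
  have S_nonneg: "0 \<le> S A N" for A N
    unfolding S_def using e by (intro sum_nonneg) auto
  \<comment> \<open>\<open>s A\<close> plays the role of the sum of \<open>e\<close> over
    \<open>A\<close>, as an order supremum instead of a norm limit.\<close>
  have "\<exists>s. (\<forall>N. S A N \<le> s) \<and> (\<forall>b. (\<forall>N. S A N \<le> b) \<longrightarrow> s \<le> b)" for A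
    using S_le by (intro sigma_Dedekind_complete_sup[OF sdc])
  then obtain s where s: "\<And>A N. S A N \<le> s A" "\<And>A b. (\<And>N. S A N \<le> b) \<Longrightarrow> s A \<le> b"
    by metis
  have s_nonneg: "0 \<le> s A" for A
    using S_nonneg s(1) order_trans by blast
  have s_le: "s A \<le> u" for A
    by (intro s(2) S_le)
  have s_add: "s (A \<union> B) = s A + s B" if "A \<inter> B = {}" for A B
  proof (rule antisym)
    have S_add: "S (A \<union> B) N = S A N + S B N" for N
      unfolding S_def Int_Un_distrib2 using that by (intro sum.union_disjoint) auto
    show "s (A \<union> B) \<le> s A + s B"
      by (intro s(2)) (simp add: S_add add_mono s(1))
    \<comment> \<open>The partial sums over \<open>A\<close> and \<open>B\<close> may stop at
      different indices; monotonicity moves both to \<open>max N N'\<close>, and the suprema are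
      then taken one at a time.\<close>
    have "s A \<le> s (A \<union> B) - s B"
    proof (rule s(2))
      fix N
      have "s B \<le> s (A \<union> B) - S A N"
      proof (rule s(2))
        fix N'
        have "S A N + S B N' \<le> S (A \<union> B) (max N N')"
          unfolding S_add by (intro add_mono S_mono) simp_all
        also have "\<dots> \<le> s (A \<union> B)"
          by (rule s(1))
        finally show "S B N' \<le> s (A \<union> B) - S A N"
          by (simp add: algebra_simps)
      qed
      then show "S A N \<le> s (A \<union> B) - s B"
        by (simp add: algebra_simps)
    qed
    then show "s A + s B \<le> s (A \<union> B)"
      by (simp add: algebra_simps)
  qed
  have s_single: "s {k} = e k" for k
  proof (rule antisym)
    show "s {k} \<le> e k"
    proof (rule s(2))
      show "S {k} N \<le> e k" for N
        using e sum_mono2[of "{k}" "{k} \<inter> {..<N}" e] by (simp add: S_def)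
    qed
    show "e k \<le> s {k}"
      using s(1)[of "{k}" "Suc k"] by (simp add: S_def)
  qed
  \<comment> \<open>A lower bound for \<open>f k\<close> off the diagonal is the aim, so mass is
    measured by the negative part of \<open>f k\<close>.\<close>
  define V where "V k A = blinfun_apply (pos_blinfun (- f k)) (s A)" for k A
  obtain M where M: "0 \<le> M" "\<And>n. norm (f n) \<le> M"
    using weak_star_null_bounded[OF f] by blast
  have V_le: "V k A \<le> M * norm u" for k A
  proof -
    have "V k A \<le> norm (f k) * norm (s A)"
      unfolding V_def using pos_blinfun_le_norm[of "- f k"] by simp
    also have "\<dots> \<le> M * norm u"
      using s_nonneg s_le by (intro mult_mono M norm_pos_mono) simp_all
    finally show ?thesis .
  qed
  obtain m where m: "M * norm u / (\<epsilon> / 2) \<le> real m"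
    using real_arch_simple by blast
  have "\<exists>B\<subseteq>UNIV. infinite B \<and> (\<forall>k\<in>B. V k (B - {k}) \<le> \<epsilon> / 2)"
  proof (rule rosenthal_disjointification)
    show "V k UNIV \<le> real m * (\<epsilon> / 2)" for k
      using V_le[of k UNIV] m \<open>0 < \<epsilon>\<close> by (simp add: field_simps)
    show "0 \<le> V k A" for k A
      by (simp add: V_def pos_blinfun_nonneg s_nonneg)
  qed (use \<open>0 < \<epsilon>\<close> in \<open>simp_all add: V_def s_add blinfun.add_right\<close>)
  then obtain B where B: "infinite B" "\<And>k. k \<in> B \<Longrightarrow> V k (B - {k}) \<le> \<epsilon> / 2"
    by blast
  have "\<epsilon> / 2 < blinfun_apply (f k) (s B)" if "k \<in> B" for k
  proof -
    have "s B = e k + s (B - {k})"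
      using s_add[of "{k}" "B - {k}"] that by (simp add: s_single insert_absorb)
    moreover have "- V k (B - {k}) \<le> blinfun_apply (f k) (s (B - {k}))"
      unfolding V_def by (intro ge_neg_pos_blinfun s_nonneg order_refl)
    ultimately show ?thesis
      using large[of k] B(2)[OF that] by (simp add: blinfun.add_right)
  qed
  moreover have "\<forall>\<^sub>F k in sequentially. blinfun_apply (f k) (s B) < \<epsilon> / 2"
    using f \<open>0 < \<epsilon>\<close> by (intro order_tendstoD(2)[of _ 0]) (auto simp: weak_star_null_def)
  then obtain K where "\<And>k. K \<le> k \<Longrightarrow> blinfun_apply (f k) (s B) < \<epsilon> / 2"
    by (auto simp: eventually_sequentially)
  moreover obtain k where "k \<in> B" "K \<le> k"
    using B(1) by (auto simp: infinite_nat_iff_unbounded_le)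
  ultimately show False
    by (meson less_asym)
qed


text \<open>Otherwise successive blocks \<open>v (m k) - v (l k)\<close> carry mass above
  \<open>\<epsilon>\<close> for functionals of increasing index, and elements \<open>e k\<close>
  below them realising this mass contradict \<open>weak_star_null_series\<close>.\<close>

lemma weak_star_null_monotone_uniform:
  fixes v :: "nat \<Rightarrow> 'a::banach_lattice"
  assumes sdc: "sigma_Dedekind_complete TYPE('a)" and f: "weak_star_null f"
    and mono: "\<And>m n. m \<le> n \<Longrightarrow> v m \<le> v n"
    and v: "\<And>n. 0 \<le> v n" "\<And>n. v n \<le> u" and "0 < \<epsilon>"
  shows "\<exists>K. \<forall>n. \<forall>m\<ge>K. blinfun_apply (pos_blinfun (f n)) (v m - v K) \<le> \<epsilon>"
proof (rule ccontr)
  let ?P = "\<lambda>n. blinfun_apply (pos_blinfun (f n))"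
  assume "\<not> ?thesis"
  then have bad: "\<exists>n m. K \<le> m \<and> \<epsilon> < ?P n (v m - v K)" for K
    by (meson not_le)
  \<comment> \<open>The values of a single functional along \<open>v\<close> increase and are
    bounded, hence are Cauchy. Starting late enough for the first \<open>N\<close> functionals, any
    offending index is therefore at least \<open>N\<close>.\<close>
  have single: "\<forall>\<^sub>F K in sequentially. \<forall>m\<ge>K. ?P n (v m - v K) \<le> \<epsilon>" for n
  proof -
    have "incseq (\<lambda>m. ?P n (v m))"
      by (intro incseq_SucI pos_blinfun_mono mono) simp
    moreover have "?P n (v m) \<le> ?P n u" for m
      by (intro pos_blinfun_mono v)
    ultimately have "convergent (\<lambda>m. ?P n (v m))"
      unfolding convergent_def using incseq_convergent[of "\<lambda>m. ?P n (v m)" "?P n u"] by metis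
    then have "Cauchy (\<lambda>m. ?P n (v m))"
      by (rule convergent_Cauchy)
    then obtain K0 where K0: "dist (?P n (v m)) (?P n (v k)) < \<epsilon>" if "K0 \<le> m" "K0 \<le> k" for m k
      using metric_CauchyD[OF _ \<open>0 < \<epsilon>\<close>] by meson
    show ?thesis
    proof (intro eventually_sequentiallyI allI impI)
      fix K m assume "K0 \<le> K" "K \<le> m"
      then show "?P n (v m - v K) \<le> \<epsilon>"
        using K0[of m K] by (simp add: dist_real_def blinfun.diff_right)
    qed
  qed
  have step: "\<exists>n l m. N \<le> n \<and> M \<le> l \<and> l \<le> m \<and> \<epsilon> < ?P n (v m - v l)" for N M
  proof -
    have "\<forall>\<^sub>F K in sequentially. (\<forall>n\<in>{..<N}. \<forall>m\<ge>K. ?P n (v m - v K) \<le> \<epsilon>) \<and> M \<le> K"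
      by (intro eventually_conj eventually_ball_finite ballI single eventually_ge_at_top) simp
    then obtain K where K: "\<And>n m. n < N \<Longrightarrow> K \<le> m \<Longrightarrow> ?P n (v m - v K) \<le> \<epsilon>" "M \<le> K"
      by (force simp: eventually_sequentially)
    obtain n m where "K \<le> m" "\<epsilon> < ?P n (v m - v K)"
      using bad by blast
    then show ?thesis
      using K by (metis not_le)
  qed
  let ?ok = "\<lambda>(n, l, m). l \<le> m \<and> \<epsilon> < ?P n (v m - v l)"
  let ?next = "\<lambda>(n, l, m) (n', l', m'). n < n' \<and> m \<le> (l' :: nat)"
  have "\<exists>t :: nat \<Rightarrow> nat \<times> nat \<times> nat. \<forall>k. ?ok (t k) \<and> ?next (t k) (t (Suc k))"
  proof (rule dependent_nat_choice)
    show "\<exists>t. ?ok t"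
      using step[of 0 0] by auto
    show "\<exists>t'. ?ok t' \<and> ?next t t'" for t
      using step[of "Suc (fst t)" "snd (snd t)"] by (auto simp: split_beta Suc_le_eq)
  qed
  then obtain t :: "nat \<Rightarrow> nat \<times> nat \<times> nat" where t: "\<forall>k. ?ok (t k) \<and> ?next (t k) (t (Suc k))" ..
  define n where "n k = fst (t k)" for k
  define l where "l k = fst (snd (t k))" for k
  define m where "m k = snd (snd (t k))" for k
  have nlm: "l k \<le> m k" "\<epsilon> < ?P (n k) (v (m k) - v (l k))" "n k < n (Suc k)" "m k \<le> l (Suc k)" for k
    using spec[OF t, of k] by (simp_all add: n_def l_def m_def split_beta)
  have "\<exists>y. 0 \<le> y \<and> y \<le> v (m k) - v (l k) \<and> \<epsilon> < blinfun_apply (f (n k)) y" for k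
    using less_pos_blinfunD[OF _ nlm(2)] mono[OF nlm(1)] by (metis diff_ge_0_iff_ge)
  then obtain e where e: "0 \<le> e k" "e k \<le> v (m k) - v (l k)" "\<epsilon> < blinfun_apply (f (n k)) (e k)" for k
    by metis
  \<comment> \<open>The blocks do not overlap, since \<open>m k \<le> l (Suc k)\<close>, so the sum
    is at most an increment of \<open>v\<close>.\<close>
  have "(\<Sum>k<N. e k) \<le> v (l N) - v (l 0)" for N
  proof (induction N)
    case (Suc N)
    have "(\<Sum>k<Suc N. e k) \<le> (v (l N) - v (l 0)) + (v (m N) - v (l N))"
      unfolding sum.lessThan_Suc by (intro add_mono Suc e)
    also have "\<dots> \<le> v (l (Suc N)) - v (l 0)"
      using mono[OF nlm(4)[of N]] by simp
    finally show ?case .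
  qed simp
  moreover have "v (l N) - v (l 0) \<le> u" for N
    using v(2)[of "l N"] v(1)[of "l 0"] by (metis add_increasing2 diff_le_eq)
  ultimately have sum: "(\<Sum>k<N. e k) \<le> u" for N
    using order_trans by blast
  have "strict_mono n"
    by (intro strict_monoI_Suc nlm)
  then have "\<exists>k. blinfun_apply (f (n k)) (e k) \<le> \<epsilon>"
    using e(1) sum by (intro weak_star_null_series[OF sdc weak_star_null_subseq[OF f]] \<open>0 < \<epsilon>\<close>)
  with e(3) show False
    by (meson not_le)
qed

section \<open>Suprema and infima of initial segments\<close>

primrec running_sup :: "(nat \<Rightarrow> 'a::semilattice_sup) \<Rightarrow> nat \<Rightarrow> 'a" where
  "running_sup a 0 = a 0"
| "running_sup a (Suc p) = sup (running_sup a p) (a (Suc p))"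

primrec running_inf :: "(nat \<Rightarrow> 'a::semilattice_inf) \<Rightarrow> nat \<Rightarrow> 'a" where
  "running_inf a 0 = a 0"
| "running_inf a (Suc p) = inf (running_inf a p) (a (Suc p))"

lemma running_sup_mono: "p \<le> q \<Longrightarrow> running_sup a p \<le> running_sup a q"
  by (rule lift_Suc_mono_le) simp_all

lemma running_sup_ge: "j \<le> p \<Longrightarrow> a j \<le> running_sup a p"
proof (rule order_trans)
  show "a j \<le> running_sup a j"
    by (cases j) simp_all
qed (rule running_sup_mono)

lemma running_sup_le: "(\<And>j. a j \<le> b) \<Longrightarrow> running_sup a p \<le> b"
  by (induction p) simp_all

lemma running_sup_le_sum:
  fixes a :: "nat \<Rightarrow> 'a::lattice_ab_group_add"
  assumes "\<And>j. 0 \<le> a j"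
  shows "running_sup a p \<le> (\<Sum>j\<le>p. a j)"
  using assms by (induction p) (simp_all add: add_increasing add_increasing2 sum_nonneg)

lemma running_inf_antimono: "p \<le> q \<Longrightarrow> running_inf a q \<le> running_inf a p"
  by (rule lift_Suc_antimono_le) simp_all

lemma running_inf_le: "running_inf a p \<le> a p"
  by (cases p) simp_all

lemma running_inf_ge: "(\<And>j. b \<le> a j) \<Longrightarrow> b \<le> running_inf a p"
  by (induction p) simp_all

text \<open>Subtracting an infimum gives a supremum of differences, which is at most the sum of
  their positive parts. Excesses over an iterated infimum thus accumulate additively.\<close>

lemma pprt_diff_inf_le:
  fixes a :: "'a::lattice_ab_group_add"
  shows "pprt (a - inf b c) \<le> pprt (a - b) + pprt (a - c)"
proof -
  have "a - inf b c = sup (a - b) (a - c)"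
    by (simp add: add_sup_distrib_left)
  moreover have "a - b \<le> pprt (a - b) + pprt (a - c)" "a - c \<le> pprt (a - b) + pprt (a - c)"
    by (simp_all add: pprt_def add_increasing add_increasing2)
  ultimately show ?thesis
    unfolding pprt_def[of "a - inf b c"] by (simp add: add_nonneg_nonneg del: diff_inf_eq_sup)
qed

text \<open>Uniformly in \<open>n\<close>, the suprema of \<open>A i, A (i + 1), \<dots>\<close> are almost exhausted by finite suprema
  \<open>G i\<close>, and the decreasing infima \<open>C k\<close> of these stop losing mass at some index \<open>K\<close>.
  So \<open>A K\<close>, which almost lies below \<open>C K\<close>, is almost controlled by \<open>G m\<close> with \<open>m > K\<close>,
  which is small for the \<open>K\<close>-th functional.\<close>

lemma weak_star_null_order_bounded_eventually:
  fixes z :: "nat \<Rightarrow> 'a::banach_lattice"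
  assumes sdc: "sigma_Dedekind_complete TYPE('a)" and f: "weak_star_null f"
    and z: "weakly_null z" "\<And>n. 0 \<le> z n" "\<And>n. z n \<le> u" and "0 < \<epsilon>"
  shows "\<forall>\<^sub>F n in sequentially. blinfun_apply (f n) (z n) \<le> \<epsilon>"
proof (rule ccontr)
  assume "\<not> ?thesis"
  then have freq: "\<exists>n\<ge>N. \<epsilon> < blinfun_apply (f n) (z n)" for N
    by (auto simp: eventually_sequentially not_le)
  \<comment> \<open>Weak nullness handles finitely many functionals at once: some later term is
    small for the positive parts of all earlier \<open>f j\<close>, while \<open>f n\<close> is
    large on it.\<close>
  have step: "\<exists>n>N. \<epsilon> < blinfun_apply (f n) (z n) \<and>
      (\<forall>j\<le>N. blinfun_apply (pos_blinfun (f j)) (z n) \<le> (1/2) ^ k)" for N k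
  proof -
    have "\<forall>\<^sub>F n in sequentially. blinfun_apply (pos_blinfun (f j)) (z n) < (1/2) ^ k" for j
      using z(1) by (intro order_tendstoD(2)[of _ 0]) (auto simp: weakly_null_def)
    then have "\<forall>\<^sub>F n in sequentially. \<forall>j\<in>{..N}. blinfun_apply (pos_blinfun (f j)) (z n) < (1/2) ^ k"
      by (intro eventually_ball_finite) simp_all
    then obtain N' where N': "\<And>n j. N' \<le> n \<Longrightarrow> j \<le> N \<Longrightarrow>
        blinfun_apply (pos_blinfun (f j)) (z n) < (1/2) ^ k"
      by (auto simp: eventually_sequentially)
    obtain n where n: "max N' (Suc N) \<le> n" "\<epsilon> < blinfun_apply (f n) (z n)"
      using freq by blast
    then show ?thesis
      using N'[of n] by (intro exI[of _ n]) (auto intro: less_imp_le)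
  qed
  have "\<exists>r :: nat \<Rightarrow> nat. \<forall>k. \<epsilon> < blinfun_apply (f (r k)) (z (r k)) \<and> (r k < r (Suc k) \<and>
      (\<forall>j\<le>r k. blinfun_apply (pos_blinfun (f j)) (z (r (Suc k))) \<le> (1/2) ^ Suc k))"
  proof (rule dependent_nat_choice)
    show "\<exists>n. \<epsilon> < blinfun_apply (f n) (z n)"
      using freq by blast
    show "\<exists>n. \<epsilon> < blinfun_apply (f n) (z n) \<and> (N < n \<and>
      (\<forall>j\<le>N. blinfun_apply (pos_blinfun (f j)) (z n) \<le> (1/2) ^ Suc k))" for N k
      using step by blast
  qed
  then obtain r :: "nat \<Rightarrow> nat" where r: "\<epsilon> < blinfun_apply (f (r k)) (z (r k))" "r k < r (Suc k)"
    "j \<le> r k \<Longrightarrow> blinfun_apply (pos_blinfun (f j)) (z (r (Suc k))) \<le> (1/2) ^ Suc k" for k j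
    by blast
  have sm: "strict_mono r"
    by (intro strict_monoI_Suc r)
  define A where "A k = z (r k)" for k
  define Q where "Q k = blinfun_apply (pos_blinfun (f (r k)))" for k
  have Q_add: "Q k (a + b) = Q k a + Q k b" and Q_diff: "Q k (a - b) = Q k a - Q k b" for k a b
    by (simp_all add: Q_def blinfun.add_right blinfun.diff_right)
  have Q_mono: "a \<le> b \<Longrightarrow> Q k a \<le> Q k b" for k a b
    by (simp add: Q_def pos_blinfun_mono)
  have A: "0 \<le> A k" "A k \<le> u" for k
    using z by (simp_all add: A_def)
  have QA: "Q i (A k) \<le> (1/2) ^ k" if ik: "i < k" for i k
  proof -
    obtain k' where k': "k = Suc k'" "i \<le> k'"
      using ik by (cases k) auto
    then have "r i \<le> r k'"
      using sm by (simp add: strict_mono_less_eq)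
    then show ?thesis
      unfolding Q_def A_def k'(1) by (rule r(3))
  qed
  have QA_large: "\<epsilon> < Q k (A k)" for k
  proof -
    have "blinfun_apply (f (r k)) (A k) \<le> Q k (A k)"
      unfolding Q_def using A by (intro le_pos_blinfun) simp_all
    then show ?thesis
      using r(1)[of k] by (simp add: A_def)
  qed
  note uniform = weak_star_null_monotone_uniform[OF sdc weak_star_null_subseq[OF f sm], folded Q_def]
  \<comment> \<open>One third for each loss: from \<open>A K\<close> to \<open>C K\<close>, from
    \<open>C K\<close> to \<open>C k\<close>, and the value at \<open>C k\<close>.\<close>
  define \<delta> where "\<delta> = \<epsilon> / 3"
  have "0 < \<delta>"
    using \<open>0 < \<epsilon>\<close> by (simp add: \<delta>_def)
  define B where "B i = running_sup (\<lambda>j. A (i + j))" for i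
  have B: "0 \<le> B i p" "B i p \<le> u" "p \<le> q \<Longrightarrow> B i p \<le> B i q" for i p q
  proof -
    show "0 \<le> B i p"
      using A(1)[of "i + 0"] running_sup_ge[of 0 p "\<lambda>j. A (i + j)"] unfolding B_def
      by (rule order_trans) simp
  qed (simp_all add: B_def running_sup_le A running_sup_mono)
  \<comment> \<open>The weights \<open>(1/2) ^ Suc i\<close> keep the accumulated excesses over the
    \<open>G i\<close> below \<open>\<delta>\<close>.\<close>
  have "\<exists>m. \<forall>n. \<forall>p\<ge>m. Q n (B i p - B i m) \<le> \<delta> * (1/2) ^ Suc i" for i
    using B \<open>0 < \<delta>\<close> by (intro uniform[of "B i" u]) simp_all
  then obtain m where m: "m i \<le> p \<Longrightarrow> Q n (B i p - B i (m i)) \<le> \<delta> * (1/2) ^ Suc i" for i n p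
    by metis
  define G where "G i = B i (m i)" for i
  define C where "C = running_inf G"
  have C: "0 \<le> C k" "C k \<le> u" "p \<le> q \<Longrightarrow> C q \<le> C p" for k p q
  proof -
    show "C k \<le> u"
      unfolding C_def G_def by (rule order_trans[OF running_inf_le B(2)])
  qed (simp_all add: C_def running_inf_ge running_inf_antimono G_def B)
  have QAG: "Q k (pprt (A k - G i)) \<le> \<delta> * (1/2) ^ Suc i" if "i \<le> k" for i k
  proof -
    let ?p = "max (m i) k"
    have "A k \<le> B i ?p"
      using running_sup_ge[of "k - i" ?p "\<lambda>j. A (i + j)"] that by (simp add: B_def)
    then have "pprt (A k - G i) \<le> B i ?p - G i"
      using B(3)[of "m i" ?p i] by (simp add: pprt_def G_def)
    then have "Q k (pprt (A k - G i)) \<le> Q k (B i ?p - B i (m i))"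
      unfolding G_def by (rule Q_mono)
    then show ?thesis
      using m[of i ?p k] by simp
  qed
  have QAC: "Q k (pprt (A k - C j)) \<le> \<delta> * (1 - (1/2) ^ Suc j)" if "j \<le> k" for j k
    using that
  proof (induction j)
    case 0
    then show ?case
      using QAG[of 0 k] by (simp add: C_def)
  next
    case (Suc j)
    have "Q k (pprt (A k - C (Suc j))) \<le> Q k (pprt (A k - C j) + pprt (A k - G (Suc j)))"
      by (intro Q_mono) (simp add: C_def pprt_diff_inf_le del: diff_inf_eq_sup)
    also have "\<dots> \<le> \<delta> * (1 - (1/2) ^ Suc j) + \<delta> * (1/2) ^ Suc (Suc j)"
      unfolding Q_add using Suc by (intro add_mono QAG) simp_all
    also have "\<dots> = \<delta> * (1 - (1/2) ^ Suc (Suc j))"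
      by (simp add: algebra_simps)
    finally show ?case .
  qed
  \<comment> \<open>Complementing in \<open>u\<close> turns the decreasing \<open>C\<close> into an
    increasing sequence.\<close>
  have "\<exists>K. \<forall>n. \<forall>m\<ge>K. Q n ((u - C m) - (u - C K)) \<le> \<delta>"
    using C \<open>0 < \<delta>\<close> by (intro uniform[of "\<lambda>k. u - C k" u]) simp_all
  then obtain K where K: "K \<le> k \<Longrightarrow> Q n (C K - C k) \<le> \<delta>" for k n
    by auto
  obtain k0 where k0: "(1/2) ^ k0 < \<delta> / 2"
    using real_arch_pow_inv[of "\<delta> / 2" "1/2"] \<open>0 < \<delta>\<close> by auto
  \<comment> \<open>\<open>k > K\<close> makes every \<open>A (k + j)\<close> small for
    \<open>Q K\<close>; \<open>k \<ge> k0\<close> makes the geometric tail from \<open>k\<close> on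
    smaller than \<open>\<delta>\<close>.\<close>
  define k where "k = max k0 (Suc K)"
  have "(1/2) ^ k \<le> (1/2 :: real) ^ k0"
    by (intro power_decreasing) (simp_all add: k_def)
  with k0 have k: "(1/2) ^ k * 2 < \<delta>"
    by linarith
  have "Q K (C k) \<le> Q K (\<Sum>j\<le>m k. A (k + j))"
  proof (rule Q_mono)
    have "C k \<le> G k"
      by (simp add: C_def running_inf_le)
    also have "\<dots> \<le> (\<Sum>j\<le>m k. A (k + j))"
      unfolding G_def B_def by (intro running_sup_le_sum A)
    finally show "C k \<le> (\<Sum>j\<le>m k. A (k + j))" .
  qed
  also have "\<dots> = (\<Sum>j\<le>m k. Q K (A (k + j)))"
    by (simp add: Q_def blinfun.sum_right)
  also have "\<dots> \<le> (\<Sum>j\<le>m k. (1/2) ^ (k + j))"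
    by (intro sum_mono QA) (simp add: k_def)
  also have "\<dots> = (1/2) ^ k * (\<Sum>j\<le>m k. (1/2) ^ j)"
    by (simp add: power_add sum_distrib_left)
  also have "\<dots> \<le> (1/2) ^ k * (\<Sum>j. (1/2) ^ j)"
    by (intro mult_left_mono sum_le_suminf) simp_all
  also have "\<dots> = (1/2) ^ k * 2"
    by (simp add: suminf_geometric)
  finally have small: "Q K (C k) < \<delta>"
    using k by simp
  have "Q K (A K - C K) \<le> Q K (pprt (A K - C K))"
    by (intro Q_mono) (simp add: pprt_def)
  also have "\<dots> \<le> \<delta> * (1 - (1/2) ^ Suc K)"
    by (intro QAC) simp
  also have "\<dots> \<le> \<delta>"
    using \<open>0 < \<delta>\<close> by (simp add: algebra_simps)
  finally have "Q K (A K) \<le> \<delta> + Q K (C K)"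
    by (simp add: Q_diff)
  moreover have "Q K (C K) \<le> \<delta> + Q K (C k)"
    using K[of k K] unfolding Q_diff by (simp add: k_def le_max_iff_disj)
  ultimately show False
    using QA_large[of K] small by (simp add: \<delta>_def)
qed

section \<open>From one-sided estimates to limits\<close>

lemma weak_star_null_uminus: "weak_star_null f \<Longrightarrow> weak_star_null (\<lambda>n. - f n)"
  unfolding weak_star_null_def by (auto simp: blinfun.minus_left intro: tendsto_eq_intros)

text \<open>The lower estimate is the upper one for the weak-star null sequence
  \<open>- f n\<close>.\<close>

lemma tendsto_zero_if_eventually_le:
  fixes f :: "nat \<Rightarrow> 'a::real_normed_vector \<Rightarrow>\<^sub>L real"
  assumes "weak_star_null f"
    and "\<And>g \<epsilon>. weak_star_null g \<Longrightarrow> 0 < \<epsilon> \<Longrightarrow> \<forall>\<^sub>F n in sequentially. blinfun_apply (g n) (x n) \<le> \<epsilon>"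
  shows "(\<lambda>n. blinfun_apply (f n) (x n)) \<longlonglongrightarrow> 0"
proof (rule tendstoI)
  fix r :: real assume "0 < r"
  then have "\<forall>\<^sub>F n in sequentially. blinfun_apply (f n) (x n) \<le> r / 2"
    "\<forall>\<^sub>F n in sequentially. blinfun_apply (- f n) (x n) \<le> r / 2"
    using assms(2)[OF assms(1) half_gt_zero] assms(2)[OF weak_star_null_uminus[OF assms(1)] half_gt_zero]
    by blast+
  then show "\<forall>\<^sub>F n in sequentially. dist (blinfun_apply (f n) (x n)) 0 < r"
    by eventually_elim (use \<open>0 < r\<close> in \<open>simp add: blinfun.minus_left abs_if\<close>)
qed

lemma weak_star_null_order_bounded:
  fixes z :: "nat \<Rightarrow> 'a::banach_lattice"
  assumes "sigma_Dedekind_complete TYPE('a)" "weak_star_null f"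
    and "weakly_null z" "\<And>n. 0 \<le> z n" "\<And>n. z n \<le> u"
  shows "(\<lambda>n. blinfun_apply (f n) (z n)) \<longlonglongrightarrow> 0"
  using assms by (intro tendsto_zero_if_eventually_le weak_star_null_order_bounded_eventually)


subsection \<open>Disjoint sequences and uaw-null sequences\<close>

lemma inf_add_sum_le:
  fixes a :: "'a::lattice_ab_group_add"
  assumes "0 \<le> a" "0 \<le> b" "0 \<le> c"
  shows "inf a (b + c) \<le> inf a b + inf a c"
proof -
  have "inf a (b + c) \<le> inf (a + inf a c) (b + inf a c)"
  proof (rule inf_greatest)
    show "inf a (b + c) \<le> a + inf a c"
      using assms by (intro le_infI1 add_increasing2) simp_all
    have "inf a (b + c) \<le> inf (b + a) (b + c)"
      using assms by (intro inf_mono order_refl) (simp add: add_increasing)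
    then show "inf a (b + c) \<le> b + inf a c"
      by (simp add: add_inf_distrib_left)
  qed
  then show ?thesis
    by (simp add: add_inf_distrib_right)
qed

lemma disjoint_sum:
  fixes y :: "nat \<Rightarrow> 'a::lattice_ab_group_add"
  assumes "\<And>k. 0 \<le> y k" "\<And>j k. j \<noteq> k \<Longrightarrow> inf (y j) (y k) = 0" and "N \<le> n"
  shows "inf (y n) (\<Sum>k<N. y k) = 0"
  using assms(3)
proof (induction N)
  case 0
  then show ?case
    using assms(1) by (simp add: inf_absorb2)
next
  case (Suc N)
  have "inf (y n) (\<Sum>k<Suc N. y k) \<le> inf (y n) (\<Sum>k<N. y k) + inf (y n) (y N)"
    unfolding sum.lessThan_Suc by (intro inf_add_sum_le assms sum_nonneg)
  also have "\<dots> = 0"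
    using Suc assms(2)[of n N] by simp
  finally show ?case
    using assms(1) by (intro antisym) (simp_all add: sum_nonneg del: sum.lessThan_Suc)
qed

text \<open>For disjoint positive elements the sum is the supremum.\<close>

lemma sum_disjoint_le:
  fixes y :: "nat \<Rightarrow> 'a::lattice_ab_group_add"
  assumes "\<And>k. 0 \<le> y k" "\<And>k. y k \<le> u" "\<And>j k. j \<noteq> k \<Longrightarrow> inf (y j) (y k) = 0"
  shows "(\<Sum>k<N. y k) \<le> u"
proof (induction N)
  case 0
  then show ?case
    using assms(1,2) order_trans by fastforce
next
  case (Suc N)
  have "y N + (\<Sum>k<N. y k) = sup (y N) (\<Sum>k<N. y k)"
    using add_eq_inf_sup[of "y N" "\<Sum>k<N. y k"] disjoint_sum[of y N N] assms(1,3) by simp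
  then show ?case
    using Suc assms(2)[of N] by (simp add: add.commute)
qed

text \<open>Truncations at \<open>u\<close> stay disjoint, so the values of a positive functional on
  them have partial sums bounded by its value at \<open>u\<close> and tend to zero.\<close>

lemma disjoint_seq_uaw_null:
  fixes x :: "nat \<Rightarrow> 'a::banach_lattice"
  assumes "disjoint_seq x"
  shows "uaw_null x"
  unfolding uaw_null_def
proof (intro allI impI)
  fix u :: 'a
  assume u: "0 \<le> u"
  define y where "y k = inf \<bar>x k\<bar> u" for k
  have y: "0 \<le> y k" "y k \<le> u" for k
    using u by (simp_all add: y_def)
  have disj: "inf (y j) (y k) = 0" if "j \<noteq> k" for j k
  proof (rule antisym)
    have "inf (y j) (y k) \<le> inf \<bar>x j\<bar> \<bar>x k\<bar>"
      unfolding y_def by (intro inf_mono) simp_all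
    also have "\<dots> = 0"
      using assms that by (simp add: disjoint_seq_def)
    finally show "inf (y j) (y k) \<le> 0" .
  qed (simp add: y)
  have "(\<lambda>k. blinfun_apply (pos_blinfun g) (y k)) \<longlonglongrightarrow> 0" for g :: "'a \<Rightarrow>\<^sub>L real"
  proof (intro summable_LIMSEQ_zero bounded_imp_summable pos_blinfun_nonneg y)
    fix N
    have "(\<Sum>k<Suc N. y k) \<le> u"
      using y disj by (rule sum_disjoint_le)
    then show "(\<Sum>k\<le>N. blinfun_apply (pos_blinfun g) (y k)) \<le> blinfun_apply (pos_blinfun g) u"
      using pos_blinfun_mono[of "\<Sum>k<Suc N. y k" u g]
      by (simp only: blinfun.sum_right lessThan_Suc_atMost)
  qed
  then have "weakly_null y"
    using y(1) by (intro weakly_null_if_dominated[of y y]) simp_all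
  then show "weakly_null (\<lambda>k. inf \<bar>x k\<bar> u)"
    unfolding y_def[abs_def] .
qed

text \<open>Kadec--Pelczynski style disjointification along a rapidly growing subsequence: what is cut
  off from \<open>x (r k)\<close> lies below a multiple of the earlier terms, where
  \<open>weak_star_null_order_bounded\<close> applies, plus a tail small in norm.\<close>

lemma disjoint_weak_star_DP_eventually:
  fixes x :: "nat \<Rightarrow> 'a::banach_lattice"
  assumes sdc: "sigma_Dedekind_complete TYPE('a)" and DP: "disjoint_weak_star_DP TYPE('a)"
    and f: "weak_star_null f" and pos: "\<And>n. 0 \<le> x n"
    and uaw: "\<And>u. 0 \<le> u \<Longrightarrow> weakly_null (\<lambda>n. inf (x n) u)"
    and R: "\<And>n. norm (x n) \<le> R" and "0 < \<epsilon>"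
  shows "\<forall>\<^sub>F n in sequentially. blinfun_apply (f n) (x n) \<le> \<epsilon>"
proof (rule ccontr)
  assume "\<not> ?thesis"
  then have freq: "\<exists>n\<ge>N. \<epsilon> < blinfun_apply (f n) (x n)" for N
    by (auto simp: eventually_sequentially not_le)
  have step: "\<exists>n>N. \<epsilon> < blinfun_apply (f n) (x n) \<and> blinfun_apply (f n) (inf (x n) u) < \<epsilon> / 3"
    if "0 \<le> u" for N u
  proof -
    have "(\<lambda>n. blinfun_apply (f n) (inf (x n) u)) \<longlonglongrightarrow> 0"
      using that by (intro weak_star_null_order_bounded[OF sdc f uaw, where u = u]) (simp_all add: pos)
    then have "\<forall>\<^sub>F n in sequentially. blinfun_apply (f n) (inf (x n) u) < \<epsilon> / 3"
      using \<open>0 < \<epsilon>\<close> by (intro order_tendstoD(2)[of _ 0]) simp_all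
    then obtain N' where N': "\<And>n. N' \<le> n \<Longrightarrow> blinfun_apply (f n) (inf (x n) u) < \<epsilon> / 3"
      by (auto simp: eventually_sequentially)
    obtain n where "max N' (Suc N) \<le> n" "\<epsilon> < blinfun_apply (f n) (x n)"
      using freq by blast
    then show ?thesis
      using N' by (intro exI[of _ n]) simp
  qed
  \<comment> \<open>The state is an index with an upper bound \<open>s\<close> for the terms chosen
    before it. Truncation at a multiple of \<open>s\<close> is order bounded, so late functionals
    are small on it.\<close>
  let ?ok = "\<lambda>(n :: nat, s :: 'a). 0 \<le> s \<and> \<epsilon> < blinfun_apply (f n) (x n)"
  let ?next = "\<lambda>k (n, s) (n', s'). n < n' \<and> s' = s + x n \<and>
    blinfun_apply (f n') (inf (x n') (4 ^ Suc k *\<^sub>R s')) < \<epsilon> / 3"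
  have "\<exists>t. \<forall>k. ?ok (t k) \<and> ?next k (t k) (t (Suc k))"
  proof (rule dependent_nat_choice)
    show "\<exists>t. ?ok t"
    proof -
      obtain n where "\<epsilon> < blinfun_apply (f n) (x n)"
        using freq by blast
      then show ?thesis
        by (intro exI[of _ "(n, 0)"]) simp
    qed
    show "\<exists>t'. ?ok t' \<and> ?next k t t'" if ok: "?ok t" for t k
    proof -
      obtain n s where ns: "t = (n, s)"
        by (cases t)
      with ok have s: "0 \<le> s + x n"
        by (simp add: pos)
      obtain n' where "n < n'" "\<epsilon> < blinfun_apply (f n') (x n')"
        "blinfun_apply (f n') (inf (x n') (4 ^ Suc k *\<^sub>R (s + x n))) < \<epsilon> / 3"
        using step[OF scaleR_nonneg_nonneg[OF _ s], of "4 ^ Suc k" n] by auto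
      then show ?thesis
        using s by (intro exI[of _ "(n', s + x n)"]) (simp add: ns)
    qed
  qed
  then obtain t where t: "\<forall>k. ?ok (t k) \<and> ?next k (t k) (t (Suc k))" ..
  define r where "r k = fst (t k)" for k
  define s where "s k = snd (t k)" for k
  have rs: "0 \<le> s k" "\<epsilon> < blinfun_apply (f (r k)) (x (r k))" "r k < r (Suc k)" "s (Suc k) = s k + x (r k)"
    "blinfun_apply (f (r (Suc k))) (inf (x (r (Suc k))) (4 ^ Suc k *\<^sub>R s (Suc k))) < \<epsilon> / 3" for k
    using spec[OF t, of k] unfolding r_def s_def split_beta by blast+
  have sm: "strict_mono r"
    by (intro strict_monoI_Suc rs)
  have s_mono: "s j \<le> s k" if "j \<le> k" for j k
    using that by (rule lift_Suc_mono_le[rotated]) (simp add: rs pos)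
  have x_le_s: "x (r j) \<le> s k" if "j < k" for j k
  proof -
    have "x (r j) \<le> s (Suc j)"
      by (simp add: rs)
    also have "\<dots> \<le> s k"
      using that by (intro s_mono) simp
    finally show ?thesis .
  qed
  define c where "c k = (1/2 :: real) ^ k *\<^sub>R x (r k)" for k
  have c_nonneg: "0 \<le> c k" for k
    by (simp add: c_def pos scaleR_nonneg_nonneg)
  have "summable (\<lambda>k. (1/2 :: real) ^ k * R)"
    by (intro summable_mult2) simp
  then have "summable c"
    by (rule summable_comparison_test'[where N = 0]) (simp add: c_def mult_left_mono R)
  \<comment> \<open>A single element dominating each \<open>x (r k)\<close> up to the factor
    \<open>2 ^ k\<close>, hence controlling all later terms at once.\<close>
  define w where "w = (\<Sum>k. c k)"
  have c_le: "c k \<le> w" for k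
    unfolding w_def using \<open>summable c\<close> c_nonneg by (rule nonneg_le_suminf)
  have w: "0 \<le> w"
    using c_nonneg c_le order_trans by blast
  define a where "a k = 4 ^ k *\<^sub>R s k" for k
  define b where "b k = (1/2 :: real) ^ k *\<^sub>R w" for k
  have a: "0 \<le> a k" and b: "0 \<le> b k" for k
    by (simp_all add: a_def b_def rs w scaleR_nonneg_nonneg)
  \<comment> \<open>Subtracting \<open>a k\<close> removes the overlap with earlier terms,
    subtracting \<open>b k\<close> that with later ones.\<close>
  define y where "y k = pprt (x (r k) - (a k + b k))" for k
  have y: "0 \<le> y k" "y k \<le> x (r k)" for k
    unfolding y_def using a b pos by (simp_all add: pprt_diff_nonneg_le)
  have disj: "inf (y j) (y k) = 0" if "j < k" for j k
  proof -
    have "inf (y k) (y j) = 0"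
    proof (rule disjoint_pprt_diff_scaleR)
      show "y k \<le> pprt (x (r k) - 4 ^ k *\<^sub>R x (r j))"
        unfolding y_def
      proof (intro pprt_mono diff_left_mono)
        have "4 ^ k *\<^sub>R x (r j) \<le> a k"
          unfolding a_def using x_le_s[OF that] by (intro scaleR_left_mono) simp_all
        then show "4 ^ k *\<^sub>R x (r j) \<le> a k + b k"
          using b by (simp add: add_increasing2)
      qed
      show "y j \<le> pprt (x (r j) - inverse (4 ^ k) *\<^sub>R x (r k))"
        unfolding y_def
      proof (intro pprt_mono diff_left_mono)
        \<comment> \<open>As \<open>j < k\<close>, the factor \<open>4 ^ k\<close> provides both the
          \<open>2 ^ k\<close> that brings \<open>x (r k)\<close> below \<open>w\<close> and the
          \<open>2 ^ j\<close> in \<open>b j\<close>.\<close>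
        have "inverse (4 ^ k) \<le> (1/2 :: real) ^ j * (1/2) ^ k"
        proof -
          have "inverse (4 ^ k) = (1/2 :: real) ^ (k + k)"
            by (simp add: power_add power_mult_distrib[symmetric] power_one_over divide_simps)
          also have "\<dots> \<le> (1/2) ^ (j + k)"
            using that by (intro power_decreasing) simp_all
          finally show ?thesis
            by (simp add: power_add)
        qed
        then have "inverse (4 ^ k) *\<^sub>R x (r k) \<le> ((1/2 :: real) ^ j * (1/2) ^ k) *\<^sub>R x (r k)"
          by (intro scaleR_right_mono pos)
        also have "\<dots> = (1/2 :: real) ^ j *\<^sub>R c k"
          by (simp add: c_def)
        also have "\<dots> \<le> b j"
          unfolding b_def by (intro scaleR_left_mono c_le) simp
        finally show "inverse (4 ^ k) *\<^sub>R x (r k) \<le> a j + b j"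
          using a by (simp add: add_increasing)
      qed
    qed (simp_all add: y)
    then show ?thesis
      by (simp add: inf_commute)
  qed
  have "disjoint_seq y"
    unfolding disjoint_seq_def
  proof (intro allI impI)
    fix j k :: nat assume "j \<noteq> k"
    then consider "j < k" | "k < j"
      by linarith
    then show "inf \<bar>y j\<bar> \<bar>y k\<bar> = 0"
      using disj[of j k] disj[of k j] by cases (simp_all add: y inf_commute)
  qed
  moreover have "bounded (range y)"
    unfolding bounded_iff using norm_pos_mono[OF y] R order_trans by blast
  moreover have "weak_star_null (\<lambda>k. f (r k))"
    using f sm by (rule weak_star_null_subseq)
  ultimately have lim: "(\<lambda>k. blinfun_apply (f (r k)) (y k)) \<longlonglongrightarrow> 0"
    using DP unfolding disjoint_weak_star_DP_def by blast
  obtain M where M: "0 \<le> M" "\<And>n. norm (f n) \<le> M"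
    using weak_star_null_bounded[OF f] by blast
  \<comment> \<open>Out of \<open>\<epsilon>\<close>, truncation at \<open>a k\<close> costs less
    than \<open>\<epsilon> / 3\<close> and the extra cut \<open>d\<close> by \<open>b k\<close> a
    vanishing amount. The choice controls truncations at successor indices only, hence
    \<open>0 < k\<close>.\<close>
  have low: "2 / 3 * \<epsilon> - M * norm w * (1/2) ^ k < blinfun_apply (f (r k)) (y k)" if "0 < k" for k
  proof -
    define d where "d = inf (x (r k)) (a k + b k) - inf (x (r k)) (a k)"
    have d: "0 \<le> d" "d \<le> b k"
      using b inf_add_le[OF b, of "x (r k)" "a k" k]
      by (simp_all add: d_def diff_le_eq add.commute le_infI2 add_increasing2 del: diff_inf_eq_sup)
    have "blinfun_apply (f (r k)) d \<le> norm (f (r k)) * norm (b k)"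
      using d by (rule blinfun_le_on_interval)
    also have "\<dots> \<le> M * norm (b k)"
      by (intro mult_right_mono M) simp
    also have "norm (b k) = norm w * (1/2) ^ k"
      by (simp add: b_def)
    finally have fd: "blinfun_apply (f (r k)) d \<le> M * norm w * (1/2) ^ k"
      by simp
    have "y k = x (r k) - inf (x (r k)) (a k) - d"
      unfolding y_def d_def using diff_pprt_diff[of "x (r k)" "a k + b k"]
      by (simp add: algebra_simps del: diff_inf_eq_sup)
    then have "blinfun_apply (f (r k)) (y k) = blinfun_apply (f (r k)) (x (r k)) -
        blinfun_apply (f (r k)) (inf (x (r k)) (a k)) - blinfun_apply (f (r k)) d"
      by (simp only: blinfun.diff_right)
    moreover have "blinfun_apply (f (r k)) (inf (x (r k)) (a k)) < \<epsilon> / 3"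
    proof -
      obtain k' where k': "k = Suc k'"
        using \<open>0 < k\<close> gr0_implies_Suc by blast
      show ?thesis
        unfolding a_def k' by (rule rs(5))
    qed
    ultimately show ?thesis
      using rs(2)[of k] fd by simp
  qed
  have "(\<lambda>k. 2 / 3 * \<epsilon> - M * norm w * (1/2) ^ k) \<longlonglongrightarrow> 2 / 3 * \<epsilon> - M * norm w * 0"
    by (intro tendsto_intros LIMSEQ_power_zero) simp
  then have "2 / 3 * \<epsilon> - M * norm w * 0 \<le> 0"
    using lim low by (intro tendsto_le[OF _ lim]) (auto intro!: eventually_sequentiallyI[of 1] less_imp_le)
  then show False
    using \<open>0 < \<epsilon>\<close> by simp
qed

text \<open>Domination by \<open>\<bar>x n\<bar>\<close> passes boundedness and uaw-nullness on to
  \<open>z\<close>; the positive and negative parts of \<open>x n\<close> are the intended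
  instances.\<close>

lemma disjoint_weak_star_DP_nonneg:
  fixes x :: "nat \<Rightarrow> 'a::banach_lattice"
  assumes sdc: "sigma_Dedekind_complete TYPE('a)" and DP: "disjoint_weak_star_DP TYPE('a)"
    and f: "weak_star_null f" and x: "bounded (range x)" "uaw_null x"
    and z: "\<And>n. 0 \<le> z n" "\<And>n. z n \<le> \<bar>x n\<bar>"
  shows "(\<lambda>n. blinfun_apply (f n) (z n)) \<longlonglongrightarrow> 0"
proof -
  obtain R where R: "norm (x n) \<le> R" for n
    using x(1) unfolding bounded_iff by auto
  have "norm (z n) \<le> R" for n
    using norm_pos_mono[OF z(1)[of n] z(2)[of n]] R[of n] by (simp add: norm_abs_lattice)
  moreover have "weakly_null (\<lambda>n. inf (z n) u)" if "0 \<le> u" for u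
  proof (rule weakly_null_if_dominated)
    show "(\<lambda>n. blinfun_apply (pos_blinfun g) (inf \<bar>x n\<bar> u)) \<longlonglongrightarrow> 0" for g :: "'a \<Rightarrow>\<^sub>L real"
      using x(2) that by (simp add: uaw_null_def weakly_null_def)
    show "0 \<le> inf (z n) u" for n
      using z that by simp
    show "inf (z n) u \<le> inf \<bar>x n\<bar> u" for n
      using z by (intro inf_mono order_refl)
  qed
  ultimately show ?thesis
    using z(1) by (intro tendsto_zero_if_eventually_le[OF f] disjoint_weak_star_DP_eventually[OF sdc DP])
qed

theorem proposition3p9:
  assumes "sigma_Dedekind_complete TYPE('a::banach_lattice)"
  shows "disjoint_weak_star_DP TYPE('a) \<longleftrightarrow> uaw_weak_star_DP TYPE('a)"
proof
  assume DP: "disjoint_weak_star_DP TYPE('a)"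
  show "uaw_weak_star_DP TYPE('a)"
    unfolding uaw_weak_star_DP_def
  proof (intro allI impI)
    fix x :: "nat \<Rightarrow> 'a" and f :: "nat \<Rightarrow> 'a \<Rightarrow>\<^sub>L real"
    assume "bounded (range x) \<and> uaw_null x \<and> weak_star_null f"
    then have x: "bounded (range x)" "uaw_null x" and f: "weak_star_null f"
      by simp_all
    have "(\<lambda>n. blinfun_apply (f n) (pprt (x n))) \<longlonglongrightarrow> 0"
      by (intro disjoint_weak_star_DP_nonneg[OF assms DP f x]) (simp_all add: pprt_le_abs)
    moreover have "(\<lambda>n. blinfun_apply (f n) (pprt (- x n))) \<longlonglongrightarrow> 0"
      using pprt_le_abs[of "- x n" for n]
      by (intro disjoint_weak_star_DP_nonneg[OF assms DP f x]) simp_all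
    ultimately have "(\<lambda>n. blinfun_apply (f n) (pprt (x n)) - blinfun_apply (f n) (pprt (- x n))) \<longlonglongrightarrow> 0 - 0"
      by (rule tendsto_diff)
    then show "(\<lambda>n. blinfun_apply (f n) (x n)) \<longlonglongrightarrow> 0"
      by (simp flip: blinfun.diff_right add: pprt_diff_pprt_minus)
  qed
next
  assume "uaw_weak_star_DP TYPE('a)"
  then show "disjoint_weak_star_DP TYPE('a)"
    unfolding uaw_weak_star_DP_def disjoint_weak_star_DP_def
    using disjoint_seq_uaw_null by blast
qed

end
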